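(* Consider pairs $(\beta_1,\beta_2)$ with $\beta_1,\beta_2\in(1,2)$, $\beta_1\ne\beta_2$. Let $c=3.1294734398566\dots$ and $c'=3.1257839569901\dots$ be the constants defined in the context. If $\beta_1+\beta_2\ge c$, then $(\beta_1,\beta_2)\in\mathcal S$. If the inequality is strict, i.e. $\beta_1+\beta_2>c$, then $(\beta_1,\beta_2)\in\mathcal O$. For every $\epsilon>0$ there exist $\beta_1,\beta_2$ with $\beta_1+\beta_2\ge c'-\epsilon$ such that $(\beta_1,\beta_2)\notin\mathcal O$.
   Context: For $\beta_1,\beta_2>1$ and $i\in\{-1,1\}$ let $T_i(x,y)=\left(\frac{x+i}{\beta_1},\frac{y+i}{\beta_2}\right)$ on $\mathbb R^2$, and let $A_{\beta_1,\beta_2}$ be the unique non-empty compact set $A$ with $A=T_1(A)\cup T_{-1}(A)$. The system $\{T_{-1},T_1\}$ satisfies the open set condition (OSC) if there is a non-empty open set $O\subset\mathbb R^2$ with $T_1(O)\subset O$, $T_{-1}(O)\subset O$ and $T_1(O)\cap T_{-1}(O)=\varnothing$. Let $\mathcal O$ be the set of $(\beta_1,\beta_2)$ for which $\{T_{-1},T_1\}$ satisfies the OSC and $\mathcal S$ the set of $(\beta_1,\beta_2)$ for which $A_{\beta_1,\beta_2}$ is totally disconnected. Constants: let $P_k(x)=x^{k+1}-2x^k+2$ and, for $k\ge4$, let $\beta_1^{(k)}<\beta_2^{(k)}$ be the two roots of $P_k$ in $(1,2)$. Then $c=3.1294734398566\dots$ is the maximum of $\beta_1+\beta_2$ over all $(\beta_1,\beta_2)$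 with $\beta_1^{(5)}\le\beta_1\le\beta_1^{(4)}$, $\beta_2^{(4)}\le\beta_2\le\beta_2^{(5)}$ and $P_4(\beta_1)P_5(\beta_2)-P_5(\beta_1)P_4(\beta_2)=0$ (attained at $\beta_1=1.2356028604456\dots$), and $c'=\beta_1^{(5)}+\beta_2^{(5)}=3.1257839569901\dots$. *)

theory Defs
  imports "HOL-Analysis.Analysis"
begin

definition T :: "real \<Rightarrow> real \<Rightarrow> real \<Rightarrow> real \<times> real \<Rightarrow> real \<times> real" where
  "T b1 b2 i = (\<lambda>(x, y). ((x + i) / b1, (y + i) / b2))"

text \<open>The attractor: for \<open>b1, b2 > 1\<close> there is exactly one such compact set.\<close>

definition attractor :: "real \<Rightarrow> real \<Rightarrow> (real \<times> real) set" where
  "attractor b1 b2 =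
     (THE A. compact A \<and> A \<noteq> {} \<and> A = T b1 b2 1 ` A \<union> T b1 b2 (- 1) ` A)"

definition OSC :: "real \<Rightarrow> real \<Rightarrow> bool" where
  "OSC b1 b2 \<longleftrightarrow>
     (\<exists>U :: (real \<times> real) set. open U \<and> U \<noteq> {} \<and>
        T b1 b2 1 ` U \<subseteq> U \<and> T b1 b2 (- 1) ` U \<subseteq> U \<and>
        T b1 b2 1 ` U \<inter> T b1 b2 (- 1) ` U = {})"

definition totally_disconnected :: "'a :: topological_space set \<Rightarrow> bool" where
  "totally_disconnected S \<longleftrightarrow> (\<forall>x \<in> S. connected_component_set S x = {x})"

definition O_set :: "(real \<times> real) set" where
  "O_set = {(b1, b2). b1 > 1 \<and> b2 > 1 \<and> OSC b1 b2}"

definition S_set :: "(real \<times> real) set" where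
  "S_set = {(b1, b2). b1 > 1 \<and> b2 > 1 \<and> totally_disconnected (attractor b1 b2)}"

definition P :: "nat \<Rightarrow> real \<Rightarrow> real" where
  "P k x = x ^ (k + 1) - 2 * x ^ k + 2"

text \<open>For \<open>k \<ge> 4\<close> the polynomial \<open>P k\<close> has exactly two roots in the open interval
  \<open>(1, 2)\<close>; the following are the smaller and the larger one. They are only meaningful
  for such \<open>k\<close>.\<close>

definition root1 :: "nat \<Rightarrow> real" where
  "root1 k = Min {x \<in> {1<..<2}. P k x = 0}"

definition root2 :: "nat \<Rightarrow> real" where
  "root2 k = Max {x \<in> {1<..<2}. P k x = 0}"

text \<open>The maximum is attained, since the constraint set is compact and contains
  \<open>(root1 4, root2 4)\<close>; numerically \<open>c_const = 3.1294734398566\<dots>\<close>,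
  attained at \<open>b1 = 1.2356\<dots>\<close>.\<close>

definition c_const :: real where
  "c_const = (GREATEST s. \<exists>b1 b2. s = b1 + b2 \<and>
      root1 5 \<le> b1 \<and> b1 \<le> root1 4 \<and> root2 4 \<le> b2 \<and> b2 \<le> root2 5 \<and>
      P 4 b1 * P 5 b2 - P 5 b1 * P 4 b2 = 0)"

text \<open>Numerically \<open>c'_const = 3.1257839569901\<dots>\<close>.\<close>

definition c'_const :: real where
  "c'_const = root1 5 + root2 5"

end

theory Submission
  imports Defs
begin

text \<open>
  Write \<open>x = 1 / b1\<close> and \<open>y = 1 / b2\<close>. Points of the attractor are pairs of signed digit
  expansions to the bases \<open>b1\<close> and \<open>b2\<close> with one common digit sequence in \<open>{1, -1}\<close>. A point
  lying in both first-level pieces has two such sequences, and half their difference is a power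
  series \<open>1 + d\<^sub>1 z + d\<^sub>2 z\<^sup>2 + \<dots>\<close> with coefficients in \<open>{-1, 0, 1}\<close> that vanishes at both
  \<open>x\<close> and \<open>y\<close> (\<open>overlap_imp_common_zero\<close>). If there is no such series, the two pieces are
  disjoint compact sets; then the pieces of each level separate points, so the attractor is totally
  disconnected, and a small neighbourhood of it witnesses the open set condition.

  Common zeros are excluded for real coefficients of modulus at most 1 by a duality argument. The
  combination \<open>y\<^sup>n x\<^sup>m - x\<^sup>n y\<^sup>m\<close> of the two evaluations (for \<open>b1 < b2\<close>) is positive for \<open>n < m\<close>
  and negative for \<open>n > m\<close>. Hence among all admissible series it is least on
  \<open>1 - z - \<dots> - z\<^sup>m\<^sup>-\<^sup>1 + z\<^sup>m\<^sup>+\<^sup>1 + z\<^sup>m\<^sup>+\<^sup>2 + \<dots>\<close>, and if that least value is positive, no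
  admissible series vanishes at both points. Positivity says \<open>pivot m b1 < pivot m b2\<close> for an
  explicit function \<open>pivot m\<close>, which first decreases and then increases on \<open>(1, \<infinity>)\<close>. Because of
  this shape the inequality on a whole strip \<open>p \<le> b1 \<le> q\<close>, \<open>b1 + b2 \<ge> s\<close> follows from two
  evaluations, and finitely many strips with \<open>m \<in> {4, 5, 6, 7}\<close> cover all pairs whose sum is at
  least \<open>3.129\<close> (\<open>pivot_separates\<close>). A single point of the curve that defines \<open>c_const\<close> shows
  \<open>c_const \<ge> 3.129\<close>.

  For the last claim, \<open>P 5 b = 0\<close> says that \<open>1 - z - \<dots> - z\<^sup>5 + z\<^sup>6 + z\<^sup>7 + \<dots>\<close> vanishes at \<open>1 / b\<close>.
  The truncations of this series, which have all coefficients in \<open>{1, -1}\<close>, have zeros at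
  parameters \<open>b1\<close> slightly below \<open>root1 5\<close> and \<open>b2\<close> above \<open>root2 5\<close>. A common zero of a
  polynomial of this kind makes two different words in \<open>T 1\<close> and \<open>T (-1)\<close> the same map, which
  is incompatible with the open set condition (\<open>exact_overlap_imp_not_OSC\<close>).
\<close>

section \<open>Unimodal functions\<close>

text \<open>If the derivative is a positive function times an increasing one, it changes sign at most once,
  from negative to positive. So one increase between two points forces increase ever after.\<close>

lemma unimodal_increase:
  fixes f w h :: "real \<Rightarrow> real"
  assumes der: "\<And>x. x > 1 \<Longrightarrow> (f has_real_derivative w x * h x) (at x)"
    and w: "\<And>x. x > 1 \<Longrightarrow> w x > 0"
    and h: "mono_on {1<..} h"
    and ord: "1 < a" "a < r" "r < b"
    and up: "f a < f r"
  shows "f r < f b"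
proof -
  obtain z where z: "a < z" "z < r" "f r - f a = (r - a) * (w z * h z)"
    using MVT2[of a r f "\<lambda>x. w x * h x"] der ord by force
  have "0 < (r - a) * (w z * h z)" using z(3) up by linarith
  hence "h z > 0"
    using w[of z] z ord by (simp add: zero_less_mult_iff)
  have pos: "w x * h x > 0" if "z \<le> x" for x
  proof -
    have "h z \<le> h x" using mono_onD[OF h, of z x] that z ord by auto
    with \<open>h z > 0\<close> w[of x] that z ord show ?thesis by auto
  qed
  show ?thesis
  proof (rule DERIV_pos_imp_increasing[where f = f])
    fix x assume "r \<le> x" "x \<le> b"
    thus "\<exists>y. DERIV f x :> y \<and> y > 0"
      using der[of x] pos[of x] z ord by (intro exI[of _ "w x * h x"]) auto
  qed (use ord in auto)
qed

section \<open>Power series with a common zero\<close>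

text \<open>The series \<open>1 - z - \<dots> - z\<^sup>m\<^sup>-\<^sup>1 + t z\<^sup>m + z\<^sup>m\<^sup>+\<^sup>1 + z\<^sup>m\<^sup>+\<^sup>2 + \<dots>\<close> vanishes at \<open>1 / b\<close> exactly for
  \<open>t = - pivot m b\<close>. Hence \<open>P 4\<close> and \<open>P 5\<close> vanish where \<open>pivot 5\<close> equals \<open>-1\<close> and \<open>1\<close>.\<close>

definition pivot :: "nat \<Rightarrow> real \<Rightarrow> real" where
  "pivot m b = b ^ m - (\<Sum>j=1..<m. b ^ j) + 1 / (b - 1)"

text \<open>In descending powers of \<open>b\<close> the derivative has a positive leading term and only negative terms
  after it, so that it becomes increasing on division by \<open>b\<^sup>m\<^sup>-\<^sup>1\<close>.\<close>

lemma pivot_unimodal: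
  assumes "1 < a" "a < r" "r < b" "pivot m a < pivot m r"
  shows "pivot m r < pivot m b"
proof -
  let ?w = "\<lambda>b::real. b ^ (m - 1)"
  let ?h = "\<lambda>b::real. real m - (\<Sum>j=1..<m. real j / b ^ (m - j)) - 1 / (b ^ (m - 1) * (b - 1)\<^sup>2)"
  show ?thesis
  proof (rule unimodal_increase[where f = "pivot m" and w = ?w and h = ?h, OF _ _ _ assms])
    fix x :: real assume x: "x > 1"
    have e: "x ^ (m - 1) * (real j / x ^ (m - j)) = real j * x ^ (j - 1)" if "j \<in> {1..<m}" for j
    proof -
      have "m - 1 = (m - j) + (j - 1)" using that by auto
      hence "x ^ (m - 1) = x ^ (m - j) * x ^ (j - 1)" by (metis power_add)
      thus ?thesis using x by simp
    qed
    have "?w x * ?h x = real m * x ^ (m - 1) - (\<Sum>j=1..<m. real j * x ^ (j - 1)) - 1 / (x - 1)\<^sup>2"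
    proof -
      have "?w x * (\<Sum>j=1..<m. real j / x ^ (m - j)) = (\<Sum>j=1..<m. real j * x ^ (j - 1))"
        unfolding sum_distrib_left by (rule sum.cong[OF refl e])
      thus ?thesis using x by (simp add: right_diff_distrib mult.commute)
    qed
    moreover have "(pivot m has_real_derivative
        real m * x ^ (m - 1) - (\<Sum>j=1..<m. real j * x ^ (j - 1)) - 1 / (x - 1)\<^sup>2) (at x)"
      unfolding pivot_def[abs_def] using x
      by (auto intro!: derivative_eq_intros sum.cong simp: power2_eq_square)
    ultimately show "(pivot m has_real_derivative ?w x * ?h x) (at x)" by simp
  next
    show "mono_on {1<..} ?h"
    proof (rule mono_onI)
      fix x y :: real assume xy: "x \<in> {1<..}" "y \<in> {1<..}" "x \<le> y"
      have "(\<Sum>j=1..<m. real j / y ^ (m - j)) \<le> (\<Sum>j=1..<m. real j / x ^ (m - j))"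
        using xy by (intro sum_mono divide_left_mono power_mono mult_pos_pos) auto
      moreover have "1 / (y ^ (m - 1) * (y - 1)\<^sup>2) \<le> 1 / (x ^ (m - 1) * (x - 1)\<^sup>2)"
        using xy by (intro divide_left_mono mult_mono power_mono mult_pos_pos) auto
      ultimately show "?h x \<le> ?h y" by linarith
    qed
  qed auto
qed

lemma sign_pattern_sums:
  fixes b :: real
  assumes b: "b > 1" and m: "m > 0"
  shows "(\<lambda>n. (if n = m then 0 else if 0 < n \<and> n < m then - 1 else 1) / b ^ n) sums (pivot m b / b ^ m)"
proof -
  (* The pattern is the all-one series minus the correction ?c, which has finitely many terms. *)
  let ?c = "\<lambda>n. if n = m then 1 else if 0 < n \<and> n < m then 2 else 0 :: real"
  have geo: "(\<lambda>n. (1 / b) ^ n) sums (1 / (1 - 1 / b))"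
    using b by (intro geometric_sums) auto
  have "(\<lambda>n. ?c n / b ^ n) sums (\<Sum>n\<in>{1..m}. ?c n / b ^ n)"
    by (rule sums_finite) (use m in auto)
  moreover have "(\<Sum>n\<in>{1..m}. ?c n / b ^ n) = (\<Sum>j=1..<m. 2 / b ^ j) + 1 / b ^ m"
  proof -
    have "{1..m} = insert m {1..<m}" using m by auto
    thus ?thesis by simp
  qed
  moreover have "(\<Sum>j=1..<m. 2 / b ^ j) = 2 * (\<Sum>j=1..<m. b ^ j) / b ^ m"
  proof -
    have "(\<Sum>j=1..<m. 2 / b ^ j) = (\<Sum>j=1..<m. 2 / b ^ (m - j))"
      by (rule sum.reindex_bij_witness[of _ "\<lambda>j. m - j" "\<lambda>j. m - j"]) auto
    also have "\<dots> = (\<Sum>j=1..<m. 2 * b ^ j / b ^ m)"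
      using b by (intro sum.cong) (auto simp: power_diff)
    finally show ?thesis by (simp add: sum_distrib_left sum_divide_distrib)
  qed
  ultimately have "(\<lambda>n. (1 / b) ^ n - ?c n / b ^ n) sums
      (1 / (1 - 1 / b) - (2 * (\<Sum>j=1..<m. b ^ j) / b ^ m + 1 / b ^ m))"
    using sums_diff[OF geo] by simp
  moreover have "1 / (1 - 1 / b) - (2 * (\<Sum>j=1..<m. b ^ j) / b ^ m + 1 / b ^ m) = pivot m b / b ^ m"
  proof -
    have "(\<Sum>j<m. b ^ j) = (b ^ m - 1) / (b - 1)"
      using b by (simp add: geometric_sum)
    moreover have "{..<m} = insert 0 {1..<m}" using m by auto
    ultimately have "(\<Sum>j=1..<m. b ^ j) = (b ^ m - 1) / (b - 1) - 1" by simp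
    thus ?thesis using b unfolding pivot_def by (simp add: field_simps)
  qed
  moreover have "(\<lambda>n. (1 / b) ^ n - ?c n / b ^ n) =
      (\<lambda>n. (if n = m then 0 else if 0 < n \<and> n < m then - 1 else 1) / b ^ n)"
    using m by (auto simp: power_one_over)
  ultimately show ?thesis by simp
qed

text \<open>The weights \<open>u n\<close> below form a combination of the two evaluations, so \<open>d\<close> has weighted sum 0.
  They change sign exactly at \<open>n = m\<close>, so the sign pattern \<open>s\<close> minimises the weighted sum among
  all coefficient sequences bounded by 1 that start with 1, and its weighted sum is the difference
  of the two pivot values.\<close>

lemma common_zero_imp_pivot_le:
  fixes b1 b2 :: real and d :: "nat \<Rightarrow> real"
  assumes b: "1 < b1" "b1 < b2" and m: "m > 0"
    and d: "d 0 = 1" "\<And>n. \<bar>d n\<bar> \<le> 1"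
    and zero: "(\<lambda>n. d n / b1 ^ n) sums 0" "(\<lambda>n. d n / b2 ^ n) sums 0"
  shows "pivot m b2 \<le> pivot m b1"
proof -
  define s :: "nat \<Rightarrow> real" where
    "s n = (if n = m then 0 else if 0 < n \<and> n < m then - 1 else 1)" for n
  define u where "u n = b2 ^ m / b2 ^ n - b1 ^ m / b1 ^ n" for n
  have u_pos: "u n \<ge> 0" if "n < m" for n
    using that b power_mono[of b1 b2 "m - n"] by (simp add: u_def flip: power_diff)
  have u_neg: "u n \<le> 0" if "n > m" for n
  proof -
    have "b ^ m / b ^ n = 1 / b ^ (n - m)" if "b > 1" for b :: real
      using that \<open>n > m\<close> by (simp add: power_diff)
    thus ?thesis using b power_mono[of b1 b2 "n - m"] by (simp add: u_def frac_le)
  qed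
  have "(\<lambda>n. b2 ^ m * (d n / b2 ^ n) - b1 ^ m * (d n / b1 ^ n)) sums (b2 ^ m * 0 - b1 ^ m * 0)"
    by (intro sums_diff sums_mult zero)
  hence du: "(\<lambda>n. d n * u n) sums 0" by (simp add: u_def algebra_simps)
  have "(\<lambda>n. b2 ^ m * (s n / b2 ^ n) - b1 ^ m * (s n / b1 ^ n)) sums
      (b2 ^ m * (pivot m b2 / b2 ^ m) - b1 ^ m * (pivot m b1 / b1 ^ m))"
    unfolding s_def by (intro sums_diff sums_mult sign_pattern_sums) (use b m in auto)
  hence su: "(\<lambda>n. s n * u n) sums (pivot m b2 - pivot m b1)"
    using b by (simp add: u_def algebra_simps)
  have "s n * u n \<le> d n * u n" for n
  proof -
    consider "n = 0" | "0 < n" "n < m" | "n = m" | "n > m" by linarith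
    thus ?thesis
    proof cases
      case 2
      with d(2)[of n] u_pos[of n] show ?thesis
        by (intro mult_right_mono) (auto simp: s_def)
    next
      case 4
      with d(2)[of n] u_neg[of n] show ?thesis
        by (intro mult_right_mono_neg) (auto simp: s_def)
    qed (use d m b in \<open>auto simp: s_def u_def\<close>)
  qed
  from sums_le[OF this su du] show ?thesis by simp
qed

lemma pivot_explicit:
  "pivot 4 b = b ^ 4 - b ^ 3 - b ^ 2 - b + 1 / (b - 1)"
  "pivot 5 b = b ^ 5 - b ^ 4 - b ^ 3 - b ^ 2 - b + 1 / (b - 1)"
  "pivot 6 b = b ^ 6 - b ^ 5 - b ^ 4 - b ^ 3 - b ^ 2 - b + 1 / (b - 1)"
  "pivot 7 b = b ^ 7 - b ^ 6 - b ^ 5 - b ^ 4 - b ^ 3 - b ^ 2 - b + 1 / (b - 1)"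
  by (simp_all add: pivot_def eval_nat_numeral)

text \<open>Consecutive breakpoints \<open>p, q\<close> bound a strip for \<open>b1\<close>, in which \<open>b1 \<le> q < s - q \<le> b2\<close>.
  Unimodality bounds \<open>pivot m b1\<close> by its values at \<open>p\<close> and \<open>q\<close>, hence by the value at
  \<open>s - q\<close>; an increase from \<open>b1\<close> to \<open>s - q\<close> then continues up to \<open>b2\<close>.\<close>

lemma pivot_less_sweep:
  assumes "successively (\<lambda>p q. 1 < p \<and> q < s - q \<and> pivot m p < pivot m (s - q) \<and> pivot m q < pivot m (s - q)) ps"
    and "ps \<noteq> []" "hd ps \<le> b1" "b1 < last ps" and "b1 + b2 \<ge> s"
  shows "pivot m b1 < pivot m b2"
  using assms
proof (induction ps rule: induct_list012)
  case (3 p q ps)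
  show ?case
  proof (cases "b1 < q")
    case False
    thus ?thesis using 3 by (cases ps) auto
  next
    case True
    let ?r = "s - q"
    have *: "1 < p" "q < ?r" "pivot m p < pivot m ?r" "pivot m q < pivot m ?r" and p: "p \<le> b1"
      using 3(3,5) by auto
    have "pivot m b1 < pivot m ?r"
    proof (rule ccontr)
      assume "\<not> ?thesis"
      hence "p \<noteq> b1" "pivot m p < pivot m b1" using * by auto
      with pivot_unimodal[of p b1 q m] * p True \<open>\<not> ?thesis\<close> show False by auto
    qed
    moreover have "pivot m ?r \<le> pivot m b2"
    proof (cases "b2 = ?r")
      case False
      with pivot_unimodal[of b1 ?r b2 m] \<open>pivot m b1 < pivot m ?r\<close> * p True 3(7) show ?thesis by auto
    qed auto
    ultimately show ?thesis by linarith
  qed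
qed auto

text \<open>The index \<open>m\<close> has to grow as \<open>b1\<close> decreases, since \<open>pivot m\<close> blows up at 1 while its value at 2
  is always 3. The condition \<open>b2 < 2\<close> keeps \<open>b1\<close> above \<open>1.129\<close>, so that four indices suffice.
  The breakpoints come from a greedy search, each strip being nearly as wide as its two
  inequalities permit; strips are narrowest around \<open>1.2\<close>, where the region of possible common
  zeros comes closest to the line \<open>b1 + b2 = 3.129\<close>.\<close>

lemma pivot_separates:
  assumes "1 < b1" "b1 < b2" "b2 < 2" and sum: "b1 + b2 \<ge> 3.129"
  shows "\<exists>m>0. pivot m b1 < pivot m b2"
proof -
  note sweep = pivot_less_sweep[OF _ _ _ _ sum]
  have lo: "1.129 \<le> b1" using assms by simp
  consider "1.129 \<le> b1" "b1 < 1.16" | "1.16 \<le> b1" "b1 < 1.202"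
    | "1.202 \<le> b1" "b1 < 1.305" | "1.305 \<le> b1" "b1 < 1.561" | "b1 \<ge> 1.561"
    using lo by (metis not_le)
  thus ?thesis
  proof cases
    case 1
    have "pivot 7 b1 < pivot 7 b2"
      by (rule sweep[of 7 "[1.129, 1.148, 1.16]"]) (use 1 in \<open>simp_all add: pivot_explicit power_divide\<close>)
    thus ?thesis by (intro exI[of _ 7]) simp
  next
    case 2
    have "pivot 6 b1 < pivot 6 b2"
      by (rule sweep[of 6 "[1.16, 1.169, 1.177, 1.184, 1.19, 1.195, 1.199, 1.202]"])
        (use 2 in \<open>simp_all add: pivot_explicit power_divide\<close>)
    thus ?thesis by (intro exI[of _ 6]) simp
  next
    case 3
    have "pivot 5 b1 < pivot 5 b2"
      by (rule sweep[of 5 "[1.202, 1.205, 1.209, 1.213, 1.218, 1.224, 1.231, 1.239, 1.248,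
            1.258, 1.269, 1.281, 1.293, 1.305]"])
        (use 3 in \<open>simp_all add: pivot_explicit power_divide\<close>)
    thus ?thesis by (intro exI[of _ 5]) simp
  next
    case 4
    have "pivot 4 b1 < pivot 4 b2"
      by (rule sweep[of 4 "[1.305, 1.319, 1.338, 1.362, 1.392, 1.428, 1.469, 1.514, 1.561]"])
        (use 4 in \<open>simp_all add: pivot_explicit power_divide\<close>)
    thus ?thesis by (intro exI[of _ 4]) simp
  next
    case 5
    (* Strips degenerate at the diagonal; there pivot 4 is already increasing. *)
    have "pivot 4 1.55 < pivot 4 1.56" by (simp add: pivot_explicit power_divide)
    hence "pivot 4 1.55 < pivot 4 b1" using pivot_unimodal[of "1.55" "1.56" b1 4] 5 by simp
    hence "pivot 4 b1 < pivot 4 b2" using pivot_unimodal[of "1.55" b1 b2 4] 5 assms by simp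
    thus ?thesis by (intro exI[of _ 4]) simp
  qed
qed

lemma no_common_zero:
  fixes d :: "nat \<Rightarrow> real"
  assumes "b1 \<in> {1<..<2}" "b2 \<in> {1<..<2}" "b1 \<noteq> b2" "b1 + b2 \<ge> 3.129"
    and "d 0 = 1" "\<And>n. \<bar>d n\<bar> \<le> 1"
    and "(\<lambda>n. d n / b1 ^ n) sums 0" "(\<lambda>n. d n / b2 ^ n) sums 0"
  shows False
proof -
  have False if xy: "1 < x" "x < y" "y < 2" "x + y \<ge> 3.129"
    "(\<lambda>n. d n / x ^ n) sums 0" "(\<lambda>n. d n / y ^ n) sums 0" for x y
  proof -
    obtain m where "m > 0" "pivot m x < pivot m y" using pivot_separates[OF xy(1-4)] by blast
    with common_zero_imp_pivot_le[OF xy(1,2) _ assms(5,6) xy(5,6), of m] show False by simp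
  qed
  from this[of b1 b2] this[of b2 b1] assms show False
    by (cases "b1 < b2") (simp_all add: add.commute)
qed

section \<open>The polynomials \<open>P k\<close> and the constant \<open>c_const\<close>\<close>

lemma P_unimodal:
  assumes "1 < a" "a < r" "r < b" "P k a < P k r"
  shows "P k r < P k b"
proof (rule unimodal_increase[where f = "P k" and w = "\<lambda>x. x ^ k"
      and h = "\<lambda>x. real (k + 1) - 2 * real k / x", OF _ _ _ assms])
  fix x :: real assume x: "x > 1"
  have "x ^ k * (real (k + 1) - 2 * real k / x) = real (k + 1) * x ^ k - 2 * (real k * x ^ (k - 1))"
    using x by (cases k) (simp_all add: right_diff_distrib)
  moreover have "(P k has_real_derivative real (k + 1) * x ^ k - 2 * (real k * x ^ (k - 1))) (at x)"
    using DERIV_add[OF DERIV_diff[OF DERIV_pow[of "k + 1"] DERIV_cmult[OF DERIV_pow[of k]]] DERIV_const]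
    unfolding P_def[abs_def] by simp
  ultimately show "(P k has_real_derivative x ^ k * (real (k + 1) - 2 * real k / x)) (at x)"
    by simp
next
  show "mono_on {1<..} (\<lambda>x. real (k + 1) - 2 * real k / x)"
    by (intro mono_onI) (auto intro!: divide_left_mono mult_pos_pos)
qed auto

lemma finite_P_roots: "finite {x \<in> {1<..<2}. P k x = 0}"
proof -
  let ?p = "monom 1 (k + 1) - monom 2 k + [:2::real:]"
  have "coeff ?p (k + 1) = 1" by (simp add: coeff_pCons split: nat.splits)
  hence "?p \<noteq> 0" by (metis coeff_0 zero_neq_one)
  hence "finite {x. poly ?p x = 0}" by (rule poly_roots_finite)
  thus ?thesis by (rule rev_finite_subset) (auto simp: P_def poly_monom)
qed

lemma continuous_on_P [continuous_intros]:
  "continuous_on A f \<Longrightarrow> continuous_on A (\<lambda>x. P k (f x))"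
  unfolding P_def by (intro continuous_intros)

lemma P_1 [simp]: "P k 1 = 1" and P_2 [simp]: "P k 2 = 2"
  by (simp_all add: P_def)

lemma root1_le: "x \<in> {1<..<2} \<Longrightarrow> P k x = 0 \<Longrightarrow> root1 k \<le> x"
  and root2_ge: "x \<in> {1<..<2} \<Longrightarrow> P k x = 0 \<Longrightarrow> x \<le> root2 k"
  unfolding root1_def root2_def using finite_P_roots[of k] by (auto intro: Min_le Max_ge)

text \<open>As \<open>P k\<close> is positive at both ends of the interval from 1 to 2, a negative value yields a root on
  either side. This makes the extremal roots well defined and locates them.\<close>

lemma root_bracket:
  assumes x: "1 < x" "x < 2" "P k x < 0"
  shows "root1 k \<in> {1<..<x}" "P k (root1 k) = 0" "root2 k \<in> {x<..<2}" "P k (root2 k) = 0"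
proof -
  let ?R = "{x \<in> {1<..<2}. P k x = 0}"
  have cont: "continuous_on S (P k)" for S
    by (rule continuous_on_P[OF continuous_on_id])
  obtain y where y: "1 \<le> y" "y \<le> x" "P k y = 0"
    using IVT2'[of "P k" x 0 1] x cont by auto
  moreover have "y \<noteq> 1" "y \<noteq> x" using y x by auto
  ultimately have y': "1 < y" "y < x" "y \<in> ?R" using x by auto
  obtain z where z: "x \<le> z" "z \<le> 2" "P k z = 0"
    using IVT'[of "P k" x 0 2] x cont by auto
  moreover have "z \<noteq> x" "z \<noteq> 2" using z x by auto
  ultimately have z': "x < z" "z < 2" "z \<in> ?R" using x by auto
  have "root1 k \<in> ?R" "root2 k \<in> ?R"
    unfolding root1_def root2_def using finite_P_roots[of k] y'(3)
    by (intro Min_in Max_in; blast)+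
  thus "P k (root1 k) = 0" "P k (root2 k) = 0" "root1 k \<in> {1<..<x}" "root2 k \<in> {x<..<2}"
    using root1_le[of y k] root2_ge[of z k] y' z' by auto
qed

text \<open>The constraint set is compact, so the maximum is attained as soon as a feasible point exists;
  without attainment the \<open>GREATEST\<close> operator would be unspecified.\<close>

lemma c_const_ge:
  assumes "root1 5 \<le> a" "a \<le> root1 4" "root2 4 \<le> b" "b \<le> root2 5"
    and "P 4 a * P 5 b - P 5 a * P 4 b = 0"
  shows "a + b \<le> c_const"
proof -
  let ?F = "\<lambda>p. P 4 (fst p) * P 5 (snd p) - P 5 (fst p) * P 4 (snd p)"
  let ?C = "({root1 5..root1 4} \<times> {root2 4..root2 5}) \<inter> {p. ?F p = 0}"
  have "compact ?C"
    by (intro compact_Int_closed compact_Times compact_Icc closed_Collect_eq continuous_intros)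
  moreover have "(a, b) \<in> ?C" using assms by auto
  moreover have "continuous_on ?C (\<lambda>p. fst p + snd p)" by (intro continuous_intros)
  ultimately obtain p where p: "p \<in> ?C" "\<And>q. q \<in> ?C \<Longrightarrow> fst q + snd q \<le> fst p + snd p"
    using continuous_attains_sup[of ?C "\<lambda>p. fst p + snd p"] by blast
  have "c_const = fst p + snd p"
    unfolding c_const_def
  proof (rule Greatest_equality)
    show "\<exists>b1 b2. fst p + snd p = b1 + b2 \<and> root1 5 \<le> b1 \<and> b1 \<le> root1 4 \<and>
        root2 4 \<le> b2 \<and> b2 \<le> root2 5 \<and> P 4 b1 * P 5 b2 - P 5 b1 * P 4 b2 = 0"
      using p(1) by (intro exI[of _ "fst p"] exI[of _ "snd p"]) auto
  next
    fix s assume "\<exists>b1 b2. s = b1 + b2 \<and> root1 5 \<le> b1 \<and> b1 \<le> root1 4 \<and>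
        root2 4 \<le> b2 \<and> b2 \<le> root2 5 \<and> P 4 b1 * P 5 b2 - P 5 b1 * P 4 b2 = 0"
    thus "s \<le> fst p + snd p" using p(2) by fastforce
  qed
  thus ?thesis using p(2)[OF \<open>(a, b) \<in> ?C\<close>] by simp
qed

text \<open>With \<open>b1 = 1.2356\<close>, close to the maximiser, the intermediate value theorem gives a point of
  the curve with \<open>b2 \<ge> 1.8935\<close>, and the sum already exceeds \<open>3.129\<close>.\<close>

lemma c_const_lower: "3.129 \<le> c_const"
proof -
  let ?a = "1.2356 :: real" and ?y = "1.8935 :: real"
  have val: "P 4 ?a > 0" "P 5 ?a < 0" "P 4 ?y > 0" "P 5 ?y < 0" "P 4 1.7 < 0"
    "P 4 ?a * P 5 ?y - P 5 ?a * P 4 ?y < 0"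
    by (simp_all add: P_def power_divide)
  note r4 = root_bracket[of "1.7" 4] and r5 = root_bracket[of ?a 5] root_bracket[of ?y 5]
  have 1: "root1 5 \<le> ?a" and 2: "?y \<le> root2 5" "P 5 (root2 5) = 0"
    using r5 val by auto
  have 3: "?a \<le> root1 4"
  proof (rule ccontr)
    assume "\<not> ?thesis"
    thus False using P_unimodal[of "root1 4" ?a "1.7" 4] r4 val by auto
  qed
  have P4: "P 4 t > 0" if "t \<ge> ?y" for t
  proof (cases "t = ?y")
    case True
    thus ?thesis by (simp only: val(3))
  next
    case False
    with P_unimodal[of "1.7" ?y t 4] val that show ?thesis by auto
  qed
  have 4: "root2 4 \<le> ?y"
    using P4[of "root2 4"] r4 val by force
  have "0 \<le> P 4 ?a * P 5 (root2 5) - P 5 ?a * P 4 (root2 5)"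
    using P4[OF 2(1)] val 2(2) by (simp add: mult_nonpos_nonneg)
  then obtain b where b: "?y \<le> b" "b \<le> root2 5" "P 4 ?a * P 5 b - P 5 ?a * P 4 b = 0"
    using IVT'[of "\<lambda>t. P 4 ?a * P 5 t - P 5 ?a * P 4 t" ?y 0 "root2 5"] val 2
    by (force intro: continuous_intros)
  have "?a + b \<le> c_const" using c_const_ge[of ?a b] 1 3 4 b by auto
  thus ?thesis using b by simp
qed

section \<open>The attractor\<close>

text \<open>Unrolling \<open>s n = (s (n + 1) + a n) / b\<close> leaves a remainder \<open>s n / b\<^sup>n\<close>, which vanishes in the
  limit. This turns a bounded orbit under the inverse maps into a digit expansion.\<close>

lemma expansion_sums:
  fixes b :: real and a s :: "nat \<Rightarrow> real"
  assumes b: "b > 1" and rec: "\<And>n. s n = (s (Suc n) + a n) / b" and bdd: "\<And>n. \<bar>s n\<bar> \<le> D"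
  shows "(\<lambda>n. a n / b ^ Suc n) sums s 0"
proof -
  have part: "(\<Sum>j<n. a j / b ^ Suc j) = s 0 - s n / b ^ n" for n
  proof (induction n)
    case (Suc n)
    have "s n / b ^ n = s (Suc n) / b ^ Suc n + a n / b ^ Suc n"
      using b by (subst rec) (simp add: field_simps)
    with Suc show ?case by simp
  qed simp
  have "(\<lambda>n. D * (1 / b) ^ n) \<longlonglongrightarrow> 0"
    using b by (intro tendsto_mult_right_zero LIMSEQ_power_zero) auto
  hence "(\<lambda>n. s n / b ^ n) \<longlonglongrightarrow> 0"
    by (rule Lim_null_comparison[rotated])
      (use b bdd in \<open>auto intro!: always_eventually divide_right_mono simp: power_one_over field_simps\<close>)
  from tendsto_diff[OF tendsto_const this, of "s 0"] show ?thesis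
    unfolding sums_def part by simp
qed

context
  fixes b1 b2 :: real
  assumes b1: "b1 > 1" and b2: "b2 > 1"
begin

definition hutchinson :: "(real \<times> real) set \<Rightarrow> (real \<times> real) set" where
  "hutchinson X = T b1 b2 1 ` X \<union> T b1 b2 (- 1) ` X"

lemma fst_T [simp]: "fst (T b1 b2 i p) = (fst p + i) / b1"
  and snd_T [simp]: "snd (T b1 b2 i p) = (snd p + i) / b2"
  by (simp_all add: T_def split: prod.splits)

lemma continuous_on_T: "continuous_on X (T b1 b2 i)"
  unfolding T_def case_prod_unfold using b1 b2 by (intro continuous_intros) auto

lemma inj_T: "inj (T b1 b2 i)"
  using b1 b2 by (auto intro!: injI simp: T_def)

lemma compact_hutchinson: "compact X \<Longrightarrow> compact (hutchinson X)"
  unfolding hutchinson_def by (intro compact_Un compact_continuous_image continuous_on_T)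

lemma hutchinson_mono: "X \<subseteq> Y \<Longrightarrow> hutchinson X \<subseteq> hutchinson Y"
  unfolding hutchinson_def by blast

lemma hutchinson_E:
  assumes "p \<in> hutchinson X"
  obtains i q where "i \<in> {1, - 1}" "q \<in> X" "p = T b1 b2 i q"
  using assms unfolding hutchinson_def by blast

lemma T_in_hutchinson: "i \<in> {1, - 1} \<Longrightarrow> q \<in> X \<Longrightarrow> T b1 b2 i q \<in> hutchinson X"
  unfolding hutchinson_def by blast

text \<open>A point of every \<open>hutchinson (K n)\<close> lies, for one fixed sign \<open>i\<close>, in all images of the sets
  \<open>K n\<close> under \<open>T i\<close>: if each sign failed at some level, both would fail at the deeper of the two.
  Injectivity then provides a single preimage.\<close>

lemma hutchinson_INT_decreasing:
  assumes "decseq K"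
  shows "hutchinson (\<Inter>n. K n) = (\<Inter>n. hutchinson (K n))"
proof
  show "(\<Inter>n. hutchinson (K n)) \<subseteq> hutchinson (\<Inter>n. K n)"
  proof
    fix p assume p: "p \<in> (\<Inter>n. hutchinson (K n))"
    have "\<exists>i \<in> {1, - 1}. \<forall>n. p \<in> T b1 b2 i ` K n"
    proof (rule ccontr)
      assume "\<not> ?thesis"
      then obtain k l where kl: "p \<notin> T b1 b2 1 ` K k" "p \<notin> T b1 b2 (- 1) ` K l" by auto
      moreover have "K (max k l) \<subseteq> K k" "K (max k l) \<subseteq> K l"
        using decseqD[OF assms] by simp_all
      moreover have "p \<in> hutchinson (K (max k l))" using p by blast
      ultimately show False unfolding hutchinson_def by blast
    qed
    then obtain i where i: "i \<in> {1, - 1}" "p \<in> (\<Inter>n. T b1 b2 i ` K n)" by blast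
    hence "p \<in> T b1 b2 i ` (\<Inter>n. K n)"
      using image_INT[OF inj_T, of UNIV K 0] by auto
    with i(1) show "p \<in> hutchinson (\<Inter>n. K n)" unfolding hutchinson_def by blast
  qed
qed (auto intro: hutchinson_mono[THEN subsetD])

text \<open>The rectangle \<open>B\<close> with half-sides \<open>1 / (b - 1)\<close> is mapped into itself, and the iterates of
  \<open>B\<close> decrease to an invariant compact set. It is nonempty since the corner \<open>(M1, M2)\<close> is the
  fixed point of \<open>T 1\<close> and belongs to all of them.\<close>

lemma attractor_exists: "\<exists>A. compact A \<and> A \<noteq> {} \<and> A = hutchinson A"
proof -
  define M1 where "M1 = 1 / (b1 - 1)"
  define M2 where "M2 = 1 / (b2 - 1)"
  define B where "B = {- M1..M1} \<times> {- M2..M2}"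
  define K where "K n = (hutchinson ^^ n) B" for n
  have M: "M1 > 0" "M2 > 0" "M1 + 1 = b1 * M1" "M2 + 1 = b2 * M2"
    using b1 b2 by (auto simp: M1_def M2_def field_simps)
  have "hutchinson B \<subseteq> B"
  proof
    fix p assume "p \<in> hutchinson B"
    then obtain i q where iq: "i \<in> {1, - 1}" "q \<in> B" "p = T b1 b2 i q" by (rule hutchinson_E)
    thus "p \<in> B" using M b1 b2
      by (auto simp: B_def T_def field_simps)
  qed
  have dec: "decseq K"
  proof (rule decseq_SucI)
    fix n show "K (Suc n) \<subseteq> K n"
    proof (induction n)
      case (Suc n)
      thus ?case using hutchinson_mono[OF Suc] by (simp add: K_def)
    qed (use \<open>hutchinson B \<subseteq> B\<close> in \<open>simp add: K_def\<close>)
  qed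
  have comp: "compact (K n)" for n
    by (induction n) (auto simp: K_def B_def intro!: compact_Times compact_hutchinson)
  have fix_pt: "(M1, M2) \<in> K n" for n
  proof (induction n)
    case (Suc n)
    have "(M1, M2) = T b1 b2 1 (M1, M2)" using M b1 b2 by (simp add: T_def)
    with Suc T_in_hutchinson[of 1 "(M1, M2)" "K n"] show ?case by (simp add: K_def)
  qed (use M in \<open>auto simp: K_def B_def\<close>)
  let ?A = "\<Inter>n. K n"
  have "hutchinson ?A = (\<Inter>n. K (Suc n))"
    unfolding hutchinson_INT_decreasing[OF dec] by (simp add: K_def)
  also have "\<dots> = ?A"
  proof (intro equalityI INT_greatest)
    fix n
    have "(\<Inter>n. K (Suc n)) \<subseteq> K (Suc n)" by (rule INT_lower) simp
    also have "\<dots> \<subseteq> K n" using decseqD[OF dec, of n "Suc n"] by simp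
    finally show "(\<Inter>n. K (Suc n)) \<subseteq> K n" .
    show "?A \<subseteq> K (Suc n)" by (rule INT_lower) simp
  qed
  finally have "?A = hutchinson ?A" ..
  moreover have "compact ?A" using comp by (intro compact_Inter) auto
  moreover have "?A \<noteq> {}" using fix_pt by blast
  ultimately show ?thesis by (intro exI[of _ ?A]) simp
qed

text \<open>Pulling \<open>x \<in> X\<close> back along \<open>n\<close> maps, choosing any point of \<open>Y\<close> there and pushing it forward
  again gives a point of \<open>Y\<close> within order \<open>b1\<^sup>-\<^sup>n + b2\<^sup>-\<^sup>n\<close> of \<open>x\<close>. Applied both ways this is the
  uniqueness of the attractor.\<close>

lemma attractor_subset:
  assumes X: "compact X" "X = hutchinson X" and Y: "compact Y" "Y \<noteq> {}" "Y = hutchinson Y"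
  shows "X \<subseteq> Y"
proof
  fix x assume x: "x \<in> X"
  have "bounded (X \<union> Y)" using X Y by (simp add: compact_imp_bounded)
  then obtain D where D: "\<And>p. p \<in> X \<union> Y \<Longrightarrow> norm p \<le> D" unfolding bounded_iff by blast
  have D': "\<bar>fst p\<bar> \<le> D" "\<bar>snd p\<bar> \<le> D" if "p \<in> X \<union> Y" for p
    using D[OF that] norm_fst_le[of "fst p" "snd p"] norm_snd_le[where x = "fst p" and y = "snd p"] by auto
  have approx: "\<exists>y\<in>Y. \<bar>fst p - fst y\<bar> \<le> 2 * D / b1 ^ n \<and> \<bar>snd p - snd y\<bar> \<le> 2 * D / b2 ^ n"
    if "p \<in> X" for p n
    using that
  proof (induction n arbitrary: p)
    case 0
    obtain y where "y \<in> Y" using Y by blast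
    with D'[of y] D'[of p] 0 show ?case by (intro bexI[of _ y]) auto
  next
    case (Suc n)
    then obtain i q where iq: "i \<in> {1, - 1}" "q \<in> X" "p = T b1 b2 i q"
      using X(2) by (metis hutchinson_E)
    obtain y where y: "y \<in> Y" "\<bar>fst q - fst y\<bar> \<le> 2 * D / b1 ^ n"
      "\<bar>snd q - snd y\<bar> \<le> 2 * D / b2 ^ n" using Suc.IH[OF iq(2)] by blast
    have "T b1 b2 i y \<in> Y" using T_in_hutchinson[OF iq(1) y(1)] Y(3) by simp
    moreover have "fst p - fst (T b1 b2 i y) = (fst q - fst y) / b1"
      "snd p - snd (T b1 b2 i y) = (snd q - snd y) / b2"
      unfolding iq(3) by (simp_all flip: diff_divide_distrib)
    hence "\<bar>fst p - fst (T b1 b2 i y)\<bar> \<le> 2 * D / b1 ^ Suc n"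
      "\<bar>snd p - snd (T b1 b2 i y)\<bar> \<le> 2 * D / b2 ^ Suc n"
      using y b1 b2 divide_right_mono[OF y(2), of b1] divide_right_mono[OF y(3), of b2]
      by (auto simp: abs_div mult.commute)
    ultimately show ?case by blast
  qed
  then obtain y where y: "\<And>n. y n \<in> Y" "\<And>n. \<bar>fst x - fst (y n)\<bar> \<le> 2 * D / b1 ^ n"
    "\<And>n. \<bar>snd x - snd (y n)\<bar> \<le> 2 * D / b2 ^ n" using x by metis
  have lim: "(\<lambda>n. 2 * D * (1 / b) ^ n) \<longlonglongrightarrow> 0" if "b > 1" for b :: real
    using that by (intro tendsto_mult_right_zero LIMSEQ_power_zero) auto
  have "(\<lambda>n. fst (y n) - fst x) \<longlonglongrightarrow> 0"
    by (rule Lim_null_comparison[OF _ lim[OF b1]])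
      (use y(2) in \<open>auto intro!: always_eventually simp: power_one_over abs_minus_commute\<close>)
  moreover have "(\<lambda>n. snd (y n) - snd x) \<longlonglongrightarrow> 0"
    by (rule Lim_null_comparison[OF _ lim[OF b2]])
      (use y(3) in \<open>auto intro!: always_eventually simp: power_one_over abs_minus_commute\<close>)
  ultimately have "(\<lambda>n. (fst (y n), snd (y n))) \<longlonglongrightarrow> (fst x, snd x)"
    by (intro tendsto_Pair) (simp_all add: LIM_zero_iff)
  with closed_sequentially[OF compact_imp_closed[OF Y(1)], of y x] y(1)
  show "x \<in> Y" by simp
qed

lemma attractor_props:
  "compact (attractor b1 b2)" "attractor b1 b2 \<noteq> {}" "attractor b1 b2 = hutchinson (attractor b1 b2)"
proof -
  have "\<exists>!A. compact A \<and> A \<noteq> {} \<and> A = hutchinson A"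
    using attractor_exists attractor_subset by (metis subset_antisym)
  from theI'[OF this]
  show "compact (attractor b1 b2)" "attractor b1 b2 \<noteq> {}" "attractor b1 b2 = hutchinson (attractor b1 b2)"
    by (simp_all add: attractor_def hutchinson_def)
qed

lemma attractor_bounded:
  obtains D where "\<And>p. p \<in> attractor b1 b2 \<Longrightarrow> \<bar>fst p\<bar> \<le> D \<and> \<bar>snd p\<bar> \<le> D"
proof -
  obtain D where D: "\<And>p. p \<in> attractor b1 b2 \<Longrightarrow> norm p \<le> D"
    using compact_imp_bounded[OF attractor_props(1)] unfolding bounded_iff by blast
  have "\<bar>fst p\<bar> \<le> D \<and> \<bar>snd p\<bar> \<le> D" if "p \<in> attractor b1 b2" for p
    using D[OF that] norm_fst_le[of "fst p" "snd p"] norm_snd_le[where x = "fst p" and y = "snd p"]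
    by (simp add: order_trans[of _ "norm p" D])
  with that show thesis by blast
qed

lemma attractor_coding:
  assumes "p \<in> attractor b1 b2"
  obtains a where "\<And>n. a n \<in> {1, - 1}"
    "(\<lambda>n. a n / b1 ^ Suc n) sums fst p" "(\<lambda>n. a n / b2 ^ Suc n) sums snd p"
proof -
  let ?A = "attractor b1 b2"
  have "\<forall>q \<in> ?A. \<exists>i r. i \<in> {1, - 1} \<and> r \<in> ?A \<and> q = T b1 b2 i r"
    using attractor_props(3) by (metis hutchinson_E)
  then obtain e nx where e: "\<And>q. q \<in> ?A \<Longrightarrow> e q \<in> {1, - 1} \<and> nx q \<in> ?A \<and> q = T b1 b2 (e q) (nx q)"
    by metis
  define s where "s n = (nx ^^ n) p" for n
  have s: "s n \<in> ?A" for n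
    by (induction n) (use assms e in \<open>auto simp: s_def\<close>)
  have step: "s n = T b1 b2 (e (s n)) (s (Suc n))" for n
    using e[OF s[of n]] by (simp add: s_def)
  obtain D where D: "\<And>p. p \<in> ?A \<Longrightarrow> \<bar>fst p\<bar> \<le> D \<and> \<bar>snd p\<bar> \<le> D"
    using attractor_bounded by blast
  have "fst (s n) = (fst (s (Suc n)) + e (s n)) / b1" "snd (s n) = (snd (s (Suc n)) + e (s n)) / b2" for n
    using step[of n] by (metis fst_T, metis snd_T)
  hence "(\<lambda>n. e (s n) / b1 ^ Suc n) sums fst (s 0)" "(\<lambda>n. e (s n) / b2 ^ Suc n) sums snd (s 0)"
    using D[OF s] expansion_sums[OF b1, of "\<lambda>n. fst (s n)" "\<lambda>n. e (s n)" D]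
      expansion_sums[OF b2, of "\<lambda>n. snd (s n)" "\<lambda>n. e (s n)" D] by blast+
  moreover have "e (s n) \<in> {1, - 1}" for n using e[OF s] by blast
  moreover have "s 0 = p" by (simp add: s_def)
  ultimately show thesis using that[of "\<lambda>n. e (s n)"] by metis
qed

text \<open>If \<open>T 1 u = T (-1) v\<close>, then both coordinates of \<open>u - v\<close> are \<open>-2\<close>; half the difference of the
  two digit sequences, shifted by one place and preceded by 1, is the required sequence.\<close>

lemma overlap_imp_common_zero:
  assumes "T b1 b2 1 ` attractor b1 b2 \<inter> T b1 b2 (- 1) ` attractor b1 b2 \<noteq> {}"
  obtains d :: "nat \<Rightarrow> real" where "d 0 = 1" "\<And>n. \<bar>d n\<bar> \<le> 1"
    "(\<lambda>n. d n / b1 ^ n) sums 0" "(\<lambda>n. d n / b2 ^ n) sums 0"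
proof -
  obtain u v where uv: "u \<in> attractor b1 b2" "v \<in> attractor b1 b2" "T b1 b2 1 u = T b1 b2 (- 1) v"
    using assms by blast
  have "fst (T b1 b2 1 u) = fst (T b1 b2 (- 1) v)" "snd (T b1 b2 1 u) = snd (T b1 b2 (- 1) v)"
    using uv(3) by simp_all
  hence diff: "(fst u - fst v) / 2 = - 1" "(snd u - snd v) / 2 = - 1"
    using b1 b2 by simp_all
  obtain a where a: "\<And>n. a n \<in> {1, - 1}"
    "(\<lambda>n. a n / b1 ^ Suc n) sums fst u" "(\<lambda>n. a n / b2 ^ Suc n) sums snd u"
    using attractor_coding[OF uv(1)] by blast
  obtain a' where a': "\<And>n. a' n \<in> {1, - 1}"
    "(\<lambda>n. a' n / b1 ^ Suc n) sums fst v" "(\<lambda>n. a' n / b2 ^ Suc n) sums snd v"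
    using attractor_coding[OF uv(2)] by blast
  define d where "d n = (case n of 0 \<Rightarrow> 1 | Suc k \<Rightarrow> (a k - a' k) / 2)" for n
  have "(\<lambda>n. d (Suc n) / b1 ^ Suc n) sums (- 1)"
    using sums_divide[OF sums_diff[OF a(2) a'(2)], of 2] unfolding diff
    by (simp add: d_def diff_divide_distrib mult.commute)
  moreover have "(\<lambda>n. d (Suc n) / b2 ^ Suc n) sums (- 1)"
    using sums_divide[OF sums_diff[OF a(3) a'(3)], of 2] unfolding diff
    by (simp add: d_def diff_divide_distrib mult.commute)
  moreover have "\<bar>d n\<bar> \<le> 1" for n
    using a(1)[of "n - 1"] a'(1)[of "n - 1"] by (cases n) (auto simp: d_def)
  moreover have "d 0 = 1" by (simp add: d_def)
  ultimately show thesis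
    using that[of d] sums_Suc[of "\<lambda>n. d n / b1 ^ n" "- 1"] sums_Suc[of "\<lambda>n. d n / b2 ^ n" "- 1"] by simp
qed

section \<open>Consequences of disjoint first-level pieces\<close>

text \<open>A connected subset cannot meet both of the disjoint closed pieces, so it lies in one of them, and
  its preimage is again a connected subset of the attractor. Each such step gains a factor
  \<open>1 / b1\<close> horizontally and \<open>1 / b2\<close> vertically.\<close>

lemma connected_subset_is_small:
  assumes disj: "T b1 b2 1 ` attractor b1 b2 \<inter> T b1 b2 (- 1) ` attractor b1 b2 = {}"
    and D: "\<And>p. p \<in> attractor b1 b2 \<Longrightarrow> \<bar>fst p\<bar> \<le> D \<and> \<bar>snd p\<bar> \<le> D"
    and C: "connected C" "C \<subseteq> attractor b1 b2" "x \<in> C" "y \<in> C"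
  shows "\<bar>fst x - fst y\<bar> \<le> 2 * D / b1 ^ n \<and> \<bar>snd x - snd y\<bar> \<le> 2 * D / b2 ^ n"
  using C
proof (induction n arbitrary: C x y)
  case 0
  hence "x \<in> attractor b1 b2" "y \<in> attractor b1 b2" by blast+
  with D[of x] D[of y] show ?case by (simp add: abs_le_iff)
next
  case (Suc n)
  let ?A = "attractor b1 b2"
  have cl: "closed (T b1 b2 i ` ?A)" for i
    by (intro compact_imp_closed compact_continuous_image continuous_on_T attractor_props)
  have "C \<subseteq> T b1 b2 1 ` ?A \<union> T b1 b2 (- 1) ` ?A"
    using Suc.prems(2) attractor_props(3) unfolding hutchinson_def by blast
  hence "T b1 b2 1 ` ?A \<inter> C = {} \<or> T b1 b2 (- 1) ` ?A \<inter> C = {}"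
    using connected_closedD[OF Suc.prems(1) _ _ cl cl, of 1 "- 1"] disj by blast
  with \<open>C \<subseteq> _ \<union> _\<close> obtain i where i: "C \<subseteq> T b1 b2 i ` ?A" by blast
  define S where "S p = (b1 * fst p - i, b2 * snd p - i)" for p :: "real \<times> real"
  have S: "S (T b1 b2 i p) = p" for p
    using b1 b2 by (auto simp: S_def prod_eq_iff)
  have "connected (S ` C)"
    unfolding S_def by (intro connected_continuous_image Suc.prems continuous_intros)
  moreover have "S ` C \<subseteq> ?A"
  proof
    fix s assume "s \<in> S ` C"
    then obtain q where "s = S (T b1 b2 i q)" "q \<in> ?A" using i by blast
    thus "s \<in> ?A" by (simp add: S)
  qed
  ultimately have "\<bar>fst (S x) - fst (S y)\<bar> \<le> 2 * D / b1 ^ n \<and> \<bar>snd (S x) - snd (S y)\<bar> \<le> 2 * D / b2 ^ n"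
    using Suc.prems by (intro Suc.IH[of "S ` C"]) auto
  moreover have "fst (S x) - fst (S y) = b1 * (fst x - fst y)" "snd (S x) - snd (S y) = b2 * (snd x - snd y)"
    by (simp_all add: S_def algebra_simps)
  ultimately have "b1 * \<bar>fst x - fst y\<bar> \<le> 2 * D / b1 ^ n \<and> b2 * \<bar>snd x - snd y\<bar> \<le> 2 * D / b2 ^ n"
    using b1 b2 by (simp add: abs_mult)
  thus ?case using b1 b2 by (simp add: field_simps)
qed

lemma disjoint_imp_totally_disconnected:
  assumes disj: "T b1 b2 1 ` attractor b1 b2 \<inter> T b1 b2 (- 1) ` attractor b1 b2 = {}"
  shows "totally_disconnected (attractor b1 b2)"
  unfolding totally_disconnected_def
proof
  let ?A = "attractor b1 b2"
  fix x assume x: "x \<in> ?A"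
  obtain D where D: "\<And>p. p \<in> ?A \<Longrightarrow> \<bar>fst p\<bar> \<le> D \<and> \<bar>snd p\<bar> \<le> D"
    using attractor_bounded by blast
  have zero: "t = 0" if "b > 1" "\<And>n. \<bar>t\<bar> \<le> 2 * D / b ^ n" for t b :: real
  proof -
    have "(\<lambda>n. 2 * D * (1 / b) ^ n) \<longlonglongrightarrow> 0"
      using that by (intro tendsto_mult_right_zero LIMSEQ_power_zero) auto
    hence "\<bar>t\<bar> \<le> 0"
      by (rule LIMSEQ_le_const) (use that in \<open>auto simp: power_one_over\<close>)
    thus ?thesis by simp
  qed
  have "y = x" if "y \<in> connected_component_set ?A x" for y
  proof -
    have "x \<in> connected_component_set ?A x" using x by (simp add: connected_component_refl)
    with connected_subset_is_small[OF disj D _ connected_component_subset that] 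
    have "\<And>n. \<bar>fst y - fst x\<bar> \<le> 2 * D / b1 ^ n \<and> \<bar>snd y - snd x\<bar> \<le> 2 * D / b2 ^ n"
      by (simp add: connected_connected_component)
    hence "fst y - fst x = 0" "snd y - snd x = 0" using zero b1 b2 by blast+
    thus ?thesis by (simp add: prod_eq_iff)
  qed
  thus "connected_component_set ?A x = {x}" using x by (auto simp: connected_component_refl)
qed

lemma dist_T_le: "dist (T b1 b2 i p) (T b1 b2 i q) \<le> dist p q"
proof -
  have "dist ((t + i) / b) ((u + i) / b) \<le> dist t u" if "b > 1" for t u b :: real
    using that mult_left_mono[of 1 b "\<bar>t - u\<bar>"]
    by (simp add: dist_real_def abs_div field_simps flip: diff_divide_distrib)
  thus ?thesis
    using b1 b2 by (simp add: dist_prod_def) (intro real_sqrt_le_mono add_mono power_mono; simp)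
qed

text \<open>The maps do not increase distances, so they preserve any metric neighbourhood of the invariant
  attractor; a radius of half the distance between the two pieces keeps the images disjoint.\<close>

lemma disjoint_imp_OSC:
  assumes disj: "T b1 b2 1 ` attractor b1 b2 \<inter> T b1 b2 (- 1) ` attractor b1 b2 = {}"
  shows "OSC b1 b2"
proof -
  let ?A = "attractor b1 b2"
  have comp: "compact (T b1 b2 i ` ?A)" for i
    by (intro compact_continuous_image continuous_on_T attractor_props)
  obtain d where d: "d > 0" "\<And>u v. u \<in> ?A \<Longrightarrow> v \<in> ?A \<Longrightarrow> d \<le> dist (T b1 b2 1 u) (T b1 b2 (- 1) v)"
    using separate_compact_closed[OF comp compact_imp_closed[OF comp] disj] by auto
  define U where "U = (\<Union>a\<in>?A. ball a (d / 2))"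
  have near: "\<exists>a\<in>?A. dist (T b1 b2 i a) (T b1 b2 i p) < d / 2" if p: "p \<in> U" for i p
  proof -
    obtain a where "a \<in> ?A" "dist a p < d / 2" using p unfolding U_def by auto
    with dist_T_le[of i a p] show ?thesis by (intro bexI[of _ a]) auto
  qed
  have inv: "T b1 b2 i ` U \<subseteq> U" if "i \<in> {1, - 1}" for i
  proof
    fix x assume "x \<in> T b1 b2 i ` U"
    then obtain p a where "x = T b1 b2 i p" "a \<in> ?A" "dist (T b1 b2 i a) (T b1 b2 i p) < d / 2"
      using near by blast
    moreover have "T b1 b2 i a \<in> ?A" 
      using T_in_hutchinson[OF that \<open>a \<in> ?A\<close>] unfolding attractor_props(3)[symmetric] .
    ultimately show "x \<in> U" unfolding U_def by auto
  qed
  have "T b1 b2 1 ` U \<inter> T b1 b2 (- 1) ` U = {}"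
  proof (rule ccontr)
    assume "\<not> ?thesis"
    then obtain p q where pq: "p \<in> U" "q \<in> U" "T b1 b2 1 p = T b1 b2 (- 1) q" by blast
    obtain a a' where a: "a \<in> ?A" "dist (T b1 b2 1 a) (T b1 b2 1 p) < d / 2"
      "a' \<in> ?A" "dist (T b1 b2 (- 1) a') (T b1 b2 (- 1) q) < d / 2"
      using near pq by meson
    have "dist (T b1 b2 1 a) (T b1 b2 (- 1) a') < d"
      using dist_triangle_half_l[of "T b1 b2 1 a" "T b1 b2 1 p" d "T b1 b2 (- 1) a'"] a pq(3)
      by simp
    with d(2)[OF a(1,3)] show False by simp
  qed
  moreover have "open U" "U \<noteq> {}" using d(1) attractor_props(2) by (auto simp: U_def)
  ultimately show ?thesis unfolding OSC_def using inv[of 1] inv[of "- 1"] by (intro exI[of _ U]) simp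
qed

end

section \<open>Exact overlaps\<close>

text \<open>One coordinate of a composition of the maps; the digits of \<open>w\<close> appear outermost first, so
  \<open>word_act b w 0\<close> is the finite expansion with the digits \<open>w\<close> to the base \<open>b\<close>.\<close>

definition word_act :: "real \<Rightarrow> real list \<Rightarrow> real \<Rightarrow> real" where
  "word_act b w x = foldr (\<lambda>i t. (t + i) / b) w x"

lemma word_act_simps [simp]: "word_act b [] x = x" "word_act b (i # w) x = (word_act b w x + i) / b"
  by (simp_all add: word_act_def)

lemma word_act_append: "word_act b (v @ w) x = word_act b v (word_act b w x)"
  by (simp add: word_act_def)

lemma foldr_T: "foldr (T b1 b2) w (x, y) = (word_act b1 w x, word_act b2 w y)"
  by (induction w) (simp_all add: T_def)

lemma word_act_affine: "b \<noteq> 0 \<Longrightarrow> word_act b w x = word_act b w 0 + x / b ^ length w"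
  by (induction w) (simp_all add: field_simps)

lemma word_act_uminus: "word_act b (map uminus w) (- x) = - word_act b w x"
  by (induction w) (simp_all add: divide_simps)

lemma foldr_T_mem:
  assumes "set w \<subseteq> {1, - 1}" "p \<in> U" "T b1 b2 1 ` U \<subseteq> U" "T b1 b2 (- 1) ` U \<subseteq> U"
  shows "foldr (T b1 b2) w p \<in> U"
  using assms(1) by (induction w) (use assms(2-) in auto)

text \<open>When the expansion of a word vanishes, the word acts as the linear map \<open>x / b\<^sup>n\<close>, and so does the
  word with all signs reversed. The two words start with different letters, so a point of an
  admissible open set would have its common image in both of the disjoint sets.\<close>

lemma exact_overlap_imp_not_OSC:
  assumes b: "b1 > 1" "b2 > 1" and w: "set w \<subseteq> {1, - 1}"
    and zero: "word_act b1 (1 # w) 0 = 0" "word_act b2 (1 # w) 0 = 0"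
  shows "\<not> OSC b1 b2"
proof
  assume "OSC b1 b2"
  then obtain U where U: "U \<noteq> {}" "T b1 b2 1 ` U \<subseteq> U" "T b1 b2 (- 1) ` U \<subseteq> U"
    "T b1 b2 1 ` U \<inter> T b1 b2 (- 1) ` U = {}" unfolding OSC_def by blast
  obtain x y where p: "(x, y) \<in> U" using U(1) by auto
  have eq: "word_act b (map uminus (1 # w)) t = word_act b (1 # w) t" if "b > 1" "word_act b (1 # w) 0 = 0" for b t
    using word_act_affine[of b "1 # w" t] word_act_affine[of b "1 # w" "- t"] word_act_uminus[of b "1 # w" "- t"] that
    by simp
  have "foldr (T b1 b2) (1 # w) (x, y) = foldr (T b1 b2) (map uminus (1 # w)) (x, y)"
    unfolding foldr_T using eq b zero by simp
  moreover have "foldr (T b1 b2) w (x, y) \<in> U" "foldr (T b1 b2) (map uminus w) (x, y) \<in> U"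
    using w by (intro foldr_T_mem p U(2,3); auto)+
  ultimately show False using U(4) by auto
qed

lemma word_act_replicate:
  assumes "b > 1"
  shows "word_act b (replicate n 1) 0 = (1 - 1 / b ^ n) / (b - 1)"
proof (induction n)
  case (Suc n)
  have "((1 - 1 / b ^ n) / (b - 1) + 1) / b = (1 - 1 / b ^ Suc n) / (b - 1)"
    using assms by (simp add: field_simps)
  with Suc show ?case by simp
qed simp

text \<open>Summing the full series instead of its truncation would give \<open>P 5 b\<close> alone in the numerator;
  the tail contributes \<open>1 / b\<^sup>n\<close>.\<close>

lemma word_act_approximant:
  assumes "b > 1"
  shows "word_act b (1 # replicate 5 (- 1) @ replicate n 1) 0 = (P 5 b - 1 / b ^ n) / (b ^ 6 * (b - 1))"
proof -
  define t where "t = word_act b (replicate n 1) 0"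
  have t: "t * (b - 1) = 1 - 1 / b ^ n"
    using assms by (simp add: t_def word_act_replicate)
  have "word_act b (1 # replicate 5 (- 1) @ replicate n 1) 0 = (t - 1 - b - b^2 - b^3 - b^4 + b^5) / b^6"
    using assms by (simp add: word_act_append eval_nat_numeral flip: t_def) (simp add: field_simps)
  also have "\<dots> = (t - 1 - b - b^2 - b^3 - b^4 + b^5) * (b - 1) / (b ^ 6 * (b - 1))"
    using assms by simp
  also have "(t - 1 - b - b^2 - b^3 - b^4 + b^5) * (b - 1) = P 5 b - 1 / b ^ n"
    using t unfolding P_def by (simp add: algebra_simps eval_nat_numeral)
  finally show ?thesis .
qed

text \<open>Both parameters are zeros of \<open>P 5 b - 1 / b\<^sup>n\<close>, which is negative at the two roots of \<open>P 5\<close>. It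
  is positive at 2, and for large \<open>n\<close> also at a chosen point below \<open>root1 5\<close>. Only a lower
  bound on the sum is asked for, so \<open>b2\<close> may lie anywhere above \<open>root2 5\<close> and only \<open>b1\<close> has to
  be close to its root.\<close>

lemma not_OSC_near_c':
  assumes "\<epsilon> > 0"
  obtains b1 b2 where "1 < b1" "b1 < b2" "b2 < 2" "b1 + b2 \<ge> c'_const - \<epsilon>" "\<not> OSC b1 b2"
proof -
  let ?h = "\<lambda>n b. P 5 b - 1 / b ^ n"
  have cont: "continuous_on {x..y} (?h n)" if "x > 0" for x y n
    using that by (intro continuous_intros) auto
  have "P 5 1.7 < 0" by (simp add: P_def power_divide)
  note root = root_bracket[of "1.7" 5, OF _ _ this, simplified]
  (* The maximum keeps x above 1 when epsilon is large. *)
  define x where "x = max (root1 5 - \<epsilon>) ((1 + root1 5) / 2)"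
  have x: "1 < x" "x < root1 5" "root1 5 - \<epsilon> \<le> x"
    using root assms by (auto simp: x_def less_max_iff_disj)
  have "P 5 x > 0"
  proof (rule ccontr)
    assume "\<not> ?thesis"
    then obtain z where z: "1 \<le> z" "z \<le> x" "P 5 z = 0"
      using IVT2'[of "P 5" x 0 1] x continuous_on_P[OF continuous_on_id] by auto
    hence "z \<noteq> 1" by auto
    with root1_le[of z 5] z x root show False by auto
  qed
  moreover have "(\<lambda>n. (1 / x) ^ n) \<longlonglongrightarrow> 0" using x by (intro LIMSEQ_power_zero) auto
  ultimately obtain n where n: "?h n x > 0"
    using order_tendstoD(2)[of _ 0 sequentially "P 5 x"]
    by (auto simp: eventually_sequentially power_one_over)
  obtain b1 where b1: "x \<le> b1" "b1 \<le> root1 5" "?h n b1 = 0"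
    using IVT2'[of "?h n" "root1 5" 0 x] n x root cont[of x] by auto
  have "1 / (2::real) ^ n \<le> 1" by simp
  hence h2: "?h n 2 > 0" unfolding P_2 by linarith
  then obtain b2 where b2: "root2 5 \<le> b2" "b2 \<le> 2" "?h n b2 = 0"
    using IVT'[of "?h n" "root2 5" 0 2] root cont[of "root2 5"] h2 by auto
  have "b2 \<noteq> 2" using b2(3) h2 by auto
  have "\<not> OSC b1 b2"
  proof (rule exact_overlap_imp_not_OSC)
    let ?w = "replicate 5 (- 1) @ replicate n (1::real)"
    show "b1 > 1" "b2 > 1" using b1 b2 x root by auto
    thus "word_act b1 (1 # ?w) 0 = 0" "word_act b2 (1 # ?w) 0 = 0"
      unfolding word_act_approximant[OF \<open>b1 > 1\<close>] word_act_approximant[OF \<open>b2 > 1\<close>] b1(3) b2(3)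
      by simp_all
    show "set ?w \<subseteq> {1, - 1}" by (auto simp: set_replicate_conv_if)
  qed
  thus thesis using that[of b1 b2] b1 b2 \<open>b2 \<noteq> 2\<close> x root by (auto simp: c'_const_def)
qed

section \<open>Total disconnectedness and the open set condition\<close>

theorem corollary1p6:
  shows "(\<forall>b1 \<in> {1<..<2}. \<forall>b2 \<in> {1<..<2}. b1 \<noteq> b2 \<longrightarrow>
            (b1 + b2 \<ge> c_const \<longrightarrow> (b1, b2) \<in> S_set) \<and>
            (b1 + b2 > c_const \<longrightarrow> (b1, b2) \<in> O_set)) \<and>
         (\<forall>\<epsilon>>0. \<exists>b1 \<in> {1<..<2}. \<exists>b2 \<in> {1<..<2}. b1 \<noteq> b2 \<and>
            b1 + b2 \<ge> c'_const - \<epsilon> \<and> (b1, b2) \<notin> O_set)"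
proof (intro conjI ballI allI impI)
  fix b1 b2 :: real
  assume b: "b1 \<in> {1<..<2}" "b2 \<in> {1<..<2}" "b1 \<noteq> b2"
  have disj: "T b1 b2 1 ` attractor b1 b2 \<inter> T b1 b2 (- 1) ` attractor b1 b2 = {}"
    if c: "b1 + b2 \<ge> c_const"
  proof (rule ccontr)
    assume "\<not> ?thesis"
    then obtain d :: "nat \<Rightarrow> real" where "d 0 = 1" "\<And>n. \<bar>d n\<bar> \<le> 1"
      "(\<lambda>n. d n / b1 ^ n) sums 0" "(\<lambda>n. d n / b2 ^ n) sums 0"
      using overlap_imp_common_zero[of b1 b2] b by auto
    moreover have "b1 + b2 \<ge> 3.129" using c c_const_lower by linarith
    ultimately show False using no_common_zero[OF b] by blast
  qed
  show "(b1, b2) \<in> S_set" if "b1 + b2 \<ge> c_const"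
    using disjoint_imp_totally_disconnected[OF _ _ disj[OF that]] b by (simp add: S_set_def)
  show "(b1, b2) \<in> O_set" if "b1 + b2 > c_const"
    using disjoint_imp_OSC[OF _ _ disj] that b by (simp add: O_set_def)
next
  fix \<epsilon> :: real
  assume "\<epsilon> > 0"
  then obtain b1 b2 where "1 < b1" "b1 < b2" "b2 < 2" "b1 + b2 \<ge> c'_const - \<epsilon>" "\<not> OSC b1 b2"
    by (rule not_OSC_near_c')
  thus "\<exists>b1\<in>{1<..<2}. \<exists>b2\<in>{1<..<2}. b1 \<noteq> b2 \<and> b1 + b2 \<ge> c'_const - \<epsilon> \<and> (b1, b2) \<notin> O_set"
    by (intro bexI[of _ b1] bexI[of _ b2]) (auto simp: O_set_def)
qed

end
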